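(* There is an absolute constant $C\in\mathbb{R}$ such that the following holds for every $\alpha\in(0,1)$ and every $a\in\mathbb{R}_+=(0,\infty)$. Let $\Omega=\{te^{i\theta}:0<\theta<\pi\alpha,\ t>0\}\subset\mathbb{C}$, $p=a\in\partial\Omega$, and $T=(\alpha a)^{1/\alpha}$. Let $G(x)=\log|\psi(x)|$ with $\psi(z)=(\alpha z)^{1/\alpha}-(\alpha a)^{1/\alpha}$ be the conformal Neumann Green's function of $\Omega$ with pole at $p$, let $\Omega_r:=\{x\in\Omega:G(x)<\log r\}$, let $|\Omega_r|$ be the area of $\Omega_r$ and $|\Omega_r|'=\frac{d}{dr}|\Omega_r|$. Then $$\int_{0^+}^{T}\left(\frac{4}{r}-\frac{2|\Omega_r|'}{|\Omega_r|}\right)dr\ \le\ -C+2\log\alpha .$$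
   Context: The map $\psi$ (principal branch) is a conformal bijection of $\Omega$ onto the upper half-plane with $\psi(p)=0$. $\int_{0^+}^T$ means $\lim_{\tau\to0^+}\int_\tau^T$. The constant $C$ does not depend on $\alpha$ or $a$. *)

theory Defs
  imports "HOL-Analysis.Analysis"
begin

definition sector :: "real \<Rightarrow> complex set" where
  "sector \<alpha> = {complex_of_real t * cis \<theta> | t \<theta>. 0 < \<theta> \<and> \<theta> < pi * \<alpha> \<and> 0 < t}"

(* On the sector the argument of z lies in (0, pi \<alpha>), a subset of (0, pi), so the principal
   complex power below is the branch mapping the sector onto the upper half-plane. *)
definition psi :: "real \<Rightarrow> real \<Rightarrow> complex \<Rightarrow> complex" where
  "psi \<alpha> a z =
     (complex_of_real \<alpha> * z) powr complex_of_real (1 / \<alpha>)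
       - complex_of_real ((\<alpha> * a) powr (1 / \<alpha>))"

definition neumann_green :: "real \<Rightarrow> real \<Rightarrow> complex \<Rightarrow> real" where
  "neumann_green \<alpha> a x = ln (cmod (psi \<alpha> a x))"

(* Points of the sector are never zeros of psi, so the junk value ln 0 = 0 plays no role here;
   only r > 0 is meaningful. *)
definition sublevel :: "real \<Rightarrow> real \<Rightarrow> real \<Rightarrow> complex set" where
  "sublevel \<alpha> a r = {x \<in> sector \<alpha>. neumann_green \<alpha> a x < ln r}"

definition sublevel_area :: "real \<Rightarrow> real \<Rightarrow> real \<Rightarrow> real" where
  "sublevel_area \<alpha> a r = measure lebesgue (sublevel \<alpha> a r)"

(* The limit, as \<tau> tends to 0 from the right, of the integrals of f over [\<tau>, T] exists and
   equals I. Integrability is required explicitly, as the integral of a non-integrable function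
   is 0 by convention. *)
definition has_integral_from_0plus :: "(real \<Rightarrow> real) \<Rightarrow> real \<Rightarrow> real \<Rightarrow> bool" where
  "has_integral_from_0plus f T I \<longleftrightarrow>
     (\<forall>\<tau>\<in>{0<..<T}. set_integrable lebesgue {\<tau>..T} f) \<and>
     ((\<lambda>\<tau>. LINT r:{\<tau>..T}|lebesgue. f r) \<longlongrightarrow> I) (at_right 0)"

end

theory Submission imports Defs begin

text \<open>
  Put \<open>w = (\<alpha>z)\<^bsup>1/\<alpha>\<^esup>\<close>, so that \<open>z = w\<^sup>\<alpha>/\<alpha>\<close> and \<open>\<psi> = w - T\<close>. The sublevel set \<open>\<Omega>\<^sub>r\<close> is the conformal image
  of the upper half-disc of radius \<open>r\<close> around \<open>T\<close>, and for \<open>r < T\<close> its area is, in polar coordinates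
  around \<open>T\<close>, the integral of \<open>s |T + s e\<^bsup>i\<theta>\<^esup>|\<^bsup>2\<alpha>-2\<^esup>\<close> over \<open>0 < s < r\<close>, \<open>0 < \<theta> < \<pi>\<close> (\<open>sublevel_polar\<close>).
  In particular the area is continuously differentiable in \<open>r\<close>, with nonnegative derivative, and
  \<open>|\<Omega>\<^sub>r| / r\<^sup>2 \<longlongrightarrow> (\<pi>/2) T\<^bsup>2\<alpha>-2\<^esup>\<close> as \<open>r \<longlongrightarrow> 0\<close> (\<open>sublevel_area_asymptotics\<close>).

  The integrand is the derivative of \<open>4 log r - 2 log |\<Omega>\<^sub>r|\<close>, so the integral equals
  \<open>2 log ((\<pi>/2) T\<^bsup>2\<alpha>\<^esup> / |\<Omega>\<^sub>T|)\<close> (\<open>has_integral_from_0plus_log_derivative\<close>). The claim thus reduces to a lower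
  bound of order \<open>T\<^bsup>2\<alpha>\<^esup>/\<alpha>\<close> for \<open>|\<Omega>\<^sub>T|\<close>. The half-disc of radius \<open>T\<close> touches \<open>w = 0\<close>, the corner of the
  sector, and contains the part \<open>|w| < T\<close>, \<open>0 < arg w < \<pi>/3\<close> near it; the image of that part is a circular
  sector of area \<open>\<pi> T\<^bsup>2\<alpha>\<^esup> / (6\<alpha>)\<close> (\<open>sublevel_area_at_T_ge\<close>). The integral is therefore at most
  \<open>2 log (3\<alpha>)\<close>, and \<open>C = -2 log 3\<close> works.
\<close>

section \<open>Area of parametrised plane regions\<close>

text \<open>
  A linear map matching orthonormal bases is an isometry, and it pulls boxes back to
  boxes with the same side lengths. It carries Lebesgue measure between the three models of
  the plane used below: pairs of reals, \<open>real^2\<close> and \<open>complex\<close>.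
\<close>

lemma lborel_distr_linear_Basis:
  fixes f :: "'a::euclidean_space \<Rightarrow> 'b::euclidean_space"
  assumes lin: "linear f" and bij: "bij_betw f Basis Basis"
  shows "distr lborel borel f = lborel"
proof (rule lborel_eqI[symmetric])
  have f_borel [measurable]: "f \<in> borel_measurable borel"
    using lin by (intro borel_measurable_continuous_onI linear_continuous_on linear_linear[THEN iffD2])
  have inner_f: "f x \<bullet> f a = x \<bullet> a" if a: "a \<in> Basis" for x a
  proof -
    have "f x = (\<Sum>b\<in>Basis. (x \<bullet> b) *\<^sub>R f b)"
      by (subst euclidean_representation[of x, symmetric])
         (simp only: linear_sum[OF lin] linear_cmul[OF lin])
    also have "\<dots> \<bullet> f a = (\<Sum>b\<in>Basis. (x \<bullet> b) * (if b = a then 1 else 0))"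
      unfolding inner_sum_left inner_scaleR_left
    proof (intro sum.cong refl)
      fix b assume b: "b \<in> (Basis :: 'a set)"
      have "f b \<in> Basis" "f a \<in> Basis" "f b = f a \<longleftrightarrow> b = a"
        using bij a b by (auto simp: bij_betw_def dest: inj_onD)
      then show "(x \<bullet> b) * (f b \<bullet> f a) = (x \<bullet> b) * (if b = a then 1 else 0)"
        by (simp add: inner_Basis)
    qed
    finally show ?thesis using a by (simp add: if_distrib[of "\<lambda>t. (x \<bullet> _) * t"] cong: if_cong)
  qed
  fix l u :: 'b assume le: "\<And>b. b \<in> Basis \<Longrightarrow> l \<bullet> b \<le> u \<bullet> b"
  define pull where "pull = (\<lambda>v :: 'b. \<Sum>a\<in>Basis. (v \<bullet> f a) *\<^sub>R a)"
  have pull: "pull v \<bullet> a = v \<bullet> f a" if "a \<in> Basis" for v a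
    using that by (simp add: pull_def)
  have "f -` box l u = box (pull l) (pull u)"
  proof (intro set_eqI)
    fix x
    have "x \<in> f -` box l u \<longleftrightarrow> (\<forall>b\<in>f ` Basis. l \<bullet> b < f x \<bullet> b \<and> f x \<bullet> b < u \<bullet> b)"
      using bij by (simp add: mem_box bij_betw_def)
    then show "x \<in> f -` box l u \<longleftrightarrow> x \<in> box (pull l) (pull u)"
      by (simp add: mem_box inner_f pull)
  qed
  then have "emeasure (distr lborel borel f) (box l u) = emeasure lborel (box (pull l) (pull u))"
    by (simp add: emeasure_distr)
  also have "\<dots> = (\<Prod>a\<in>Basis. (pull u - pull l) \<bullet> a)"
    using le bij by (intro emeasure_lborel_box) (auto simp: pull bij_betw_def)
  also have "(\<Prod>a\<in>Basis. (pull u - pull l) \<bullet> a) = (\<Prod>a\<in>Basis. (u - l) \<bullet> f a)"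
    by (simp add: pull inner_diff_left)
  also have "\<dots> = (\<Prod>b\<in>Basis. (u - l) \<bullet> b)"
    by (rule prod.reindex_bij_betw[OF bij])
  finally show "emeasure (distr lborel borel f) (box l u) = (\<Prod>b\<in>Basis. (u - l) \<bullet> b)" .
qed simp

text \<open>
  The area formula for a parametrisation of a plane region by pairs of reals, with \<open>u\<close> and
  \<open>v\<close> as complex partial derivatives. The \<open>2 \<times> 2\<close> determinant with columns \<open>u\<close> and \<open>v\<close> is
  \<open>Im (cnj u * v)\<close>, which makes Jacobians of holomorphic maps in polar coordinates immediate.
  The change of variables theorem on \<open>real^2\<close> is transported along coordinate isometries.
\<close>

lemma measure_image_eq_integral_jacobian:
  fixes g :: "real \<times> real \<Rightarrow> complex" and u v :: "real \<times> real \<Rightarrow> complex"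
  assumes S: "open S"
    and der: "\<And>x. x \<in> S \<Longrightarrow> (g has_derivative (\<lambda>h. fst h *\<^sub>R u x + snd h *\<^sub>R v x)) (at x)"
    and inj: "inj_on g S"
    and int: "set_integrable lborel S (\<lambda>x. \<bar>Im (cnj (u x) * v x)\<bar>)"
  shows "open (g ` S)"
    and "measure lebesgue (g ` S) = (LINT x:S|lborel. \<bar>Im (cnj (u x) * v x)\<bar>)"
proof -
  define P :: "real \<times> real \<Rightarrow> real^2" where "P = (\<lambda>p. vector [fst p, snd p])"
  define Q :: "real^2 \<Rightarrow> real \<times> real" where "Q = (\<lambda>v. (v $ 1, v $ 2))"
  define K :: "real^2 \<Rightarrow> complex" where "K = (\<lambda>v. Complex (v $ 1) (v $ 2))"
  define L :: "complex \<Rightarrow> real^2" where "L = (\<lambda>z. vector [Re z, Im z])"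
  define J where "J = (\<lambda>x. \<bar>Im (cnj (u x) * v x)\<bar>)"
  have QP [simp]: "Q (P p) = p" and PQ [simp]: "P (Q w) = w" for p w
    by (auto simp: P_def Q_def vec_eq_iff forall_2)
  have LK [simp]: "L (K w) = w" and KL [simp]: "K (L z) = z" for w z
    by (auto simp: K_def L_def vec_eq_iff forall_2)
  have linQ: "linear Q" and linK: "linear K" and linL: "linear L"
    by (auto intro!: linearI simp: P_def Q_def K_def L_def vec_eq_iff forall_2 complex_eq_iff)
  have B2: "(Basis :: (real^2) set) = {axis 1 1, axis 2 1}"
    by (auto simp: Basis_vec_def UNIV_2)
  have ax: "axis 1 (1::real) $ (1::2) = 1" "axis 1 (1::real) $ (2::2) = 0"
       "axis 2 (1::real) $ (1::2) = 0" "axis 2 (1::real) $ (2::2) = 1"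
    by (auto simp: axis_def)
  have "bij_betw Q Basis Basis"
    by (rule bij_betw_byWitness[where f' = P])
       (auto simp: B2 ax Basis_prod_def, auto simp: Q_def P_def ax vec_eq_iff forall_2)
  then have dQ: "distr lborel borel Q = lborel" by (rule lborel_distr_linear_Basis[OF linQ])
  have "bij_betw K Basis Basis"
    by (rule bij_betw_byWitness[where f' = L])
       (auto simp: B2 ax Basis_complex_def, auto simp: K_def L_def ax vec_eq_iff forall_2 complex_eq_iff)
  then have dK: "distr lborel borel K = lborel" by (rule lborel_distr_linear_Basis[OF linK])
  have [measurable]: "Q \<in> borel_measurable borel" "K \<in> borel_measurable borel"
    using linQ linK
    by (auto intro!: borel_measurable_continuous_onI linear_continuous_on linear_linear[THEN iffD2])

  define S' where "S' = Q -` S"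
  have S'_eq: "S' = P ` S" unfolding S'_def
    by (metis PQ QP bij_vimage_eq_inv_image bij_betw_byWitness image_eqI subsetI vimage_eq subset_antisym image_subset_iff)
  have S'open: "open S'"
    unfolding S'_def using S linQ by (intro open_vimage) (auto intro: linear_continuous_on linear_linear[THEN iffD2])
  define G where "G = (\<lambda>w. L (g (Q w)))"
  define G' where "G' = (\<lambda>w h. L (fst (Q h) *\<^sub>R u (Q w) + snd (Q h) *\<^sub>R v (Q w)))"
  have derG: "(G has_derivative G' w) (at w)" if "w \<in> S'" for w
  proof -
    have 1: "(Q has_derivative Q) (at w)" by (intro linear_imp_has_derivative linQ)
    have 2: "(g has_derivative (\<lambda>h. fst h *\<^sub>R u (Q w) + snd h *\<^sub>R v (Q w))) (at (Q w))"
      using that by (intro der) (simp add: S'_def)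
    have 3: "(L has_derivative L) (at (g (Q w)))" by (intro linear_imp_has_derivative linL)
    show ?thesis
      using has_derivative_compose[OF has_derivative_compose[OF 1 2] 3]
      by (simp add: G_def[abs_def] G'_def[abs_def])
  qed
  have injG: "inj_on G S'"
    using inj unfolding inj_on_def G_def S'_def by (metis KL PQ vimageE)
  have contG: "continuous_on S' G"
    using derG by (meson continuous_at_imp_continuous_on has_derivative_continuous)
  have openG: "open (G ` S')"
    by (rule invariance_of_domain[OF contG S'open injG])
  have GS: "G ` S' = K -` (g ` S)"
  proof -
    have "G ` S' = L ` (g ` S)" by (simp add: G_def S'_eq image_image)
    also have "\<dots> = K -` (g ` S)" by (auto intro: image_eqI[where x = "K _"])
    finally show ?thesis .
  qed
  have "g ` S = L -` (G ` S')" unfolding GS by auto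
  then show op: "open (g ` S)"
    using openG linL by (auto intro!: open_vimage linear_continuous_on linear_linear[THEN iffD2])
  have det: "\<bar>det (matrix (G' w))\<bar> = J (Q w)" for w
    by (simp add: det_2 matrix_def G'_def Q_def ax L_def J_def algebra_simps)
  have int': "integrable lborel (\<lambda>x. indicator S x *\<^sub>R J x)"
    using int unfolding set_integrable_def J_def .
  have meas [measurable]: "(\<lambda>x. indicator S x *\<^sub>R J x) \<in> borel_measurable borel"
    using borel_measurable_integrable[OF int'] by simp
  have ind: "indicator S (Q w) = (indicator S' w :: real)" for w
    by (simp add: S'_def indicator_def)
  have "integrable (distr lborel borel Q) (\<lambda>x. indicator S x *\<^sub>R J x)"
    unfolding dQ by (rule int')
  then have intQ: "set_integrable lborel S' (\<lambda>w. J (Q w))"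
    by (subst (asm) integrable_distr_eq[OF _ meas]) (auto simp: set_integrable_def ind)
  have "(LINT x:S|lborel. J x) = (LINT w:S'|lborel. J (Q w))"
    unfolding set_lebesgue_integral_def
    by (subst dQ[symmetric], subst integral_distr[OF _ meas]) (auto simp: ind)
  also have "\<dots> = integral S' (\<lambda>w. J (Q w))"
    by (rule set_borel_integral_eq_integral(2)[OF intQ])
  also have "\<dots> = measure lebesgue (G ` S')"
    unfolding det[symmetric]
  proof (rule measure_differentiable_image_eq[symmetric])
    show "S' \<in> sets lebesgue" using S'open by simp
    show "(G has_derivative G' x) (at x within S')" if "x \<in> S'" for x
      using derG[OF that] by (rule has_derivative_at_withinI)
    show "(\<lambda>x. \<bar>det (matrix (G' x))\<bar>) integrable_on S'"
      unfolding det by (rule set_borel_integral_eq_integral(1)[OF intQ])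
  qed (rule injG)
  also have "\<dots> = measure lborel (K -` (g ` S))"
    using openG by (simp add: GS measure_completion)
  also have "\<dots> = measure (distr lborel borel K) (g ` S)"
    using op by (simp add: measure_distr)
  also have "\<dots> = measure lebesgue (g ` S)"
    unfolding dK using op by (simp add: measure_completion)
  finally show "measure lebesgue (g ` S) = (LINT x:S|lborel. \<bar>Im (cnj (u x) * v x)\<bar>)"
    by (simp add: J_def)
qed

section \<open>The power map from the half-plane to the sector\<close>

definition power_map :: "real \<Rightarrow> complex \<Rightarrow> complex" where
  "power_map \<alpha> w = w powr complex_of_real \<alpha> / complex_of_real \<alpha>"

lemma powr_of_real_polar:
  assumes "0 < t" "- pi < \<theta>" "\<theta> \<le> pi"
  shows "(complex_of_real t * cis \<theta>) powr complex_of_real b = complex_of_real (t powr b) * cis (b * \<theta>)"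
proof -
  have "Ln (complex_of_real t * cis \<theta>) = Complex (ln t) \<theta>"
    using assms by (intro Ln_unique) (auto simp: exp_eq_polar exp_of_real)
  then have "(complex_of_real t * cis \<theta>) powr complex_of_real b = exp (of_real b * Complex (ln t) \<theta>)"
    using assms by (simp add: powr_def)
  also have "\<dots> = complex_of_real (t powr b) * cis (b * \<theta>)"
    using assms by (simp add: exp_eq_polar powr_def)
  finally show ?thesis .
qed

lemma upper_half_plane_polar:
  assumes "0 < Im w"
  obtains \<rho> \<phi> where "0 < \<rho>" "0 < \<phi>" "\<phi> < pi" "w = complex_of_real \<rho> * cis \<phi>"
proof
  have w: "w \<noteq> 0" using assms by auto
  then show "0 < cmod w" by simp
  show "w = complex_of_real (cmod w) * cis (Arg w)"
    using rcis_cmod_Arg[of w] by (simp add: rcis_def)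
  show "0 < Arg w" "Arg w < pi"
    using assms Arg_lt_pi[of w] by auto
qed

text \<open>
  Since \<open>0 < \<alpha> < 1\<close>, multiplying an argument in \<open>(0, \<pi>)\<close> by \<open>\<alpha>\<close> keeps it in \<open>(0, \<pi>)\<close>; no branch cut
  is crossed, and the two principal powers are mutually inverse.
\<close>

lemma power_map_inverse:
  assumes "0 < \<alpha>" "\<alpha> < 1" "0 < Im w"
  shows "power_map \<alpha> w \<in> sector \<alpha>"
    and "(complex_of_real \<alpha> * power_map \<alpha> w) powr complex_of_real (1 / \<alpha>) = w"
proof -
  obtain \<rho> \<phi> where w: "0 < \<rho>" "0 < \<phi>" "\<phi> < pi" "w = complex_of_real \<rho> * cis \<phi>"
    using upper_half_plane_polar[OF assms(3)] .
  have p: "w powr \<alpha> = complex_of_real (\<rho> powr \<alpha>) * cis (\<alpha> * \<phi>)"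
    unfolding w(4) using w by (intro powr_of_real_polar) auto
  have ang: "0 < \<alpha> * \<phi>" "\<alpha> * \<phi> < pi * \<alpha>" using assms w by (auto simp: mult.commute)
  have *: "w powr \<alpha> / \<alpha> = complex_of_real (\<rho> powr \<alpha> / \<alpha>) * cis (\<alpha> * \<phi>)"
    by (simp add: p)
  with ang w assms show "power_map \<alpha> w \<in> sector \<alpha>"
    unfolding sector_def power_map_def by (intro CollectI exI conjI) (assumption | simp)+
  have "\<alpha> * \<phi> < pi" using ang assms by (smt (verit) mult_less_cancel_left2 pi_gt_zero)
  then have "(complex_of_real (\<rho> powr \<alpha>) * cis (\<alpha> * \<phi>)) powr complex_of_real (1 / \<alpha>)
      = complex_of_real ((\<rho> powr \<alpha>) powr (1 / \<alpha>)) * cis (1 / \<alpha> * (\<alpha> * \<phi>))"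
    using ang w by (intro powr_of_real_polar) auto
  also have "\<dots> = w" using w assms by (simp add: powr_powr)
  finally show "(complex_of_real \<alpha> * power_map \<alpha> w) powr complex_of_real (1 / \<alpha>) = w"
    using assms by (simp add: p power_map_def)
qed

lemma sector_eq_power_map_image:
  assumes "0 < \<alpha>" "\<alpha> < 1"
  shows "sector \<alpha> = power_map \<alpha> ` {w. 0 < Im w}"
proof
  show "power_map \<alpha> ` {w. 0 < Im w} \<subseteq> sector \<alpha>"
    using power_map_inverse(1)[OF assms] by auto
  show "sector \<alpha> \<subseteq> power_map \<alpha> ` {w. 0 < Im w}"
  proof
    fix z assume "z \<in> sector \<alpha>"
    then obtain t \<theta> where z: "z = complex_of_real t * cis \<theta>" "0 < \<theta>" "\<theta> < pi * \<alpha>" "0 < t"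
      unfolding sector_def by auto
    define \<rho> where "\<rho> = (\<alpha> * t) powr (1 / \<alpha>)"
    have \<phi>: "0 < \<theta> / \<alpha>" "\<theta> / \<alpha> < pi" using z assms by (auto simp: field_simps)
    have \<rho>: "\<rho> > 0" using z assms by (simp add: \<rho>_def)
    have "(complex_of_real \<rho> * cis (\<theta> / \<alpha>)) powr \<alpha> = complex_of_real (\<rho> powr \<alpha>) * cis (\<alpha> * (\<theta> / \<alpha>))"
      using \<phi> \<rho> by (intro powr_of_real_polar) auto
    also have "\<dots> = complex_of_real (\<alpha> * t) * cis \<theta>"
      using z assms by (simp add: \<rho>_def powr_powr)
    finally have "z = power_map \<alpha> (complex_of_real \<rho> * cis (\<theta> / \<alpha>))"
      using assms z by (simp add: power_map_def)
    moreover have "0 < Im (complex_of_real \<rho> * cis (\<theta> / \<alpha>))"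
      using \<phi> \<rho> by (simp add: sin_gt_zero)
    ultimately show "z \<in> power_map \<alpha> ` {w. 0 < Im w}" by blast
  qed
qed

text \<open>
  In the coordinate \<open>w = (\<alpha>z)\<^bsup>1/\<alpha>\<^esup>\<close> the map \<open>\<psi>\<close> is the translation \<open>w - T\<close>, so sublevel sets of
  \<open>log |\<psi>|\<close> are half-discs around \<open>T\<close>.
\<close>

lemma sublevel_eq_half_disc_image:
  assumes "0 < \<alpha>" "\<alpha> < 1" "0 < r" and T: "T = (\<alpha> * a) powr (1 / \<alpha>)"
  shows "sublevel \<alpha> a r = power_map \<alpha> ` {w. 0 < Im w \<and> cmod (w - complex_of_real T) < r}"
proof -
  have "neumann_green \<alpha> a (power_map \<alpha> w) < ln r \<longleftrightarrow> cmod (w - complex_of_real T) < r" if "0 < Im w" for w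
  proof -
    have "psi \<alpha> a (power_map \<alpha> w) = w - complex_of_real T"
      unfolding psi_def power_map_inverse(2)[OF assms(1,2) that] T ..
    moreover have "w - complex_of_real T \<noteq> 0" using that by (auto simp: complex_eq_iff)
    ultimately show ?thesis using \<open>0 < r\<close> by (simp add: neumann_green_def)
  qed
  then show ?thesis
    unfolding sublevel_def sector_eq_power_map_image[OF assms(1,2)] by auto
qed

lemma mem_box_zero_Pair:
  "p \<in> box (0, 0) (r, b) \<longleftrightarrow> 0 < fst p \<and> fst p < r \<and> 0 < snd p \<and> snd p < b"
  for p :: "real \<times> real"
  by (cases p) (auto simp: mem_box Basis_prod_def)

lemma sublevel_mono:
  assumes "0 < r" "r \<le> s"
  shows "sublevel \<alpha> a r \<subseteq> sublevel \<alpha> a s"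
proof -
  have "ln r \<le> ln s" using assms by simp
  then show ?thesis unfolding sublevel_def by auto
qed

lemma half_disc_eq_polar_image:
  "{w. 0 < Im w \<and> cmod (w - complex_of_real T) < r} = (\<lambda>p. complex_of_real T + fst p *\<^sub>R cis (snd p)) ` box (0, 0) (r, pi)"
proof (intro set_eqI iffI)
  fix w assume w: "w \<in> {w. 0 < Im w \<and> cmod (w - complex_of_real T) < r}"
  then obtain \<rho> \<phi> where "0 < \<rho>" "0 < \<phi>" "\<phi> < pi" "w - complex_of_real T = complex_of_real \<rho> * cis \<phi>"
    using upper_half_plane_polar[of "w - complex_of_real T"] by auto
  moreover from this w have "\<rho> < r" by (simp add: norm_mult)
  ultimately show "w \<in> (\<lambda>p. complex_of_real T + fst p *\<^sub>R cis (snd p)) ` box (0, 0) (r, pi)"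
    by (intro image_eqI[where x = "(\<rho>, \<phi>)"])
       (auto simp: mem_box_zero_Pair scaleR_conv_of_real algebra_simps)
next
  fix w assume "w \<in> (\<lambda>p. complex_of_real T + fst p *\<^sub>R cis (snd p)) ` box (0, 0) (r, pi)"
  then show "w \<in> {w. 0 < Im w \<and> cmod (w - complex_of_real T) < r}"
    by (auto simp: mem_box_zero_Pair sin_gt_zero)
qed

lemma inj_on_polar:
  "inj_on (\<lambda>p. complex_of_real T + fst p *\<^sub>R cis (snd p)) ({0<..} \<times> {0<..<pi})"
proof (rule inj_onI, clarsimp)
  fix s t x y :: real
  assume st: "0 < s" "0 < t" "0 < x" "x < pi" "0 < y" "y < pi" and eq: "s *\<^sub>R cis x = t *\<^sub>R cis y"
  have "cmod (s *\<^sub>R cis x) = cmod (t *\<^sub>R cis y)" by (simp only: eq)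
  with st have "s = t" by simp
  moreover have "Arg (s *\<^sub>R cis x) = x" "Arg (t *\<^sub>R cis y) = y"
    using st Arg_unique'[of s x "s *\<^sub>R cis x"] Arg_unique'[of t y "t *\<^sub>R cis y"]
    by (auto simp: rcis_def scaleR_conv_of_real)
  ultimately show "s = t \<and> x = y" using eq by metis
qed

section \<open>The area of a sublevel set in polar coordinates\<close>

text \<open>
  The Jacobian \<open>|w|\<^bsup>2\<alpha>-2\<^esup>\<close> of \<^const>\<open>power_map\<close> integrated over the angles of the half-circle of radius
  \<open>s\<close> around \<open>T\<close>. Multiplied by \<open>s\<close>, it is the rate of growth of the area of the sublevel set.
\<close>

definition arc_density :: "real \<Rightarrow> real \<Rightarrow> real \<Rightarrow> real" where
  "arc_density \<alpha> T s =
     integral {0..pi} (\<lambda>\<theta>. cmod (complex_of_real T + s *\<^sub>R cis \<theta>) powr (2 * \<alpha> - 2))"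

text \<open>
  Circles of radius below \<open>T\<close> around \<open>T\<close> stay in the right half-plane, away from the singularity of
  \<open>|w|\<^bsup>2\<alpha>-2\<^esup>\<close> at the origin and from the branch cut of the power.
\<close>

lemma Re_polar_pos:
  assumes "\<bar>s\<bar> < T"
  shows "0 < Re (complex_of_real T + s *\<^sub>R cis \<theta>)"
proof -
  have "\<bar>s * cos \<theta>\<bar> \<le> \<bar>s\<bar> * 1"
    unfolding abs_mult by (intro mult_left_mono) auto
  with assms have "- T < s * cos \<theta>" by linarith
  then show ?thesis by simp
qed

lemma continuous_on_polar_density:
  "continuous_on ({-T<..<T} \<times> UNIV)
     (\<lambda>(s, \<theta>). cmod (complex_of_real T + s *\<^sub>R cis \<theta>) powr (2 * \<alpha> - 2))"
proof -
  have "complex_of_real T + s *\<^sub>R cis \<theta> \<noteq> 0" if "s \<in> {-T<..<T}" for s \<theta>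
    using Re_polar_pos[of s T \<theta>] that by force
  then show ?thesis
    unfolding case_prod_beta cis_conv_exp by (intro continuous_intros) (auto simp: cis_conv_exp)
qed

lemma continuous_on_arc_density: "continuous_on {-T<..<T} (arc_density \<alpha> T)"
proof -
  have "continuous_on {-T<..<T} (\<lambda>s. integral (cbox 0 pi)
     (\<lambda>\<theta>. cmod (complex_of_real T + s *\<^sub>R cis \<theta>) powr (2 * \<alpha> - 2)))"
    by (intro integral_continuous_on_param continuous_on_subset[OF continuous_on_polar_density]) auto
  then show ?thesis by (simp add: arc_density_def[abs_def])
qed

lemma set_integrable_box_of_continuous:
  fixes f :: "'a::euclidean_space \<Rightarrow> real"
  assumes "continuous_on (cbox a b) f"
  shows "set_integrable lborel (box a b) f" "(LINT x:box a b|lborel. f x) = integral (cbox a b) f"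
proof -
  have "set_integrable lborel (cbox a b) f"
    using borel_integrable_compact[OF compact_cbox assms] by (simp add: set_integrable_def)
  then show *: "set_integrable lborel (box a b) f"
    by (rule set_integrable_subset) (auto simp: box_subset_cbox)
  show "(LINT x:box a b|lborel. f x) = integral (cbox a b) f"
    using set_borel_integral_eq_integral(2)[OF *] by (simp add: integral_open_interval)
qed

text \<open>
  The composition of polar coordinates around \<open>T\<close> with \<^const>\<open>power_map\<close> parametrises the sublevel set
  by a rectangle, with Jacobian \<open>s |w|\<^bsup>2\<alpha>-2\<^esup>\<close>. This is continuous on the closed rectangle because
  \<open>r < T\<close>, so Fubini's theorem for continuous functions applies.
\<close>

lemma sublevel_polar:
  assumes "0 < \<alpha>" "\<alpha> < 1" "0 < r" "r < T" and T: "T = (\<alpha> * a) powr (1 / \<alpha>)"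
  shows "open (sublevel \<alpha> a r)"
    and "sublevel_area \<alpha> a r = integral {0..r} (\<lambda>s. s * arc_density \<alpha> T s)"
proof -
  define W where "W = (\<lambda>p. complex_of_real T + fst p *\<^sub>R cis (snd p))"
  define D where "D = (\<lambda>p. W p powr (complex_of_real \<alpha> - 1))"
  define J where "J = (\<lambda>p. fst p * cmod (W p) powr (2 * \<alpha> - 2))"
  define g where "g = (\<lambda>p. power_map \<alpha> (W p))"
  define u where "u = (\<lambda>p. D p * cis (snd p))"
  define v where "v = (\<lambda>p. D p * (fst p *\<^sub>R (\<i> * cis (snd p))))"
  let ?S = "box (0, 0) (r, pi) :: (real \<times> real) set"
  have img: "sublevel \<alpha> a r = g ` ?S"
    using sublevel_eq_half_disc_image[OF assms(1-3) T]
    by (simp add: g_def W_def half_disc_eq_polar_image image_image)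
  have ReW: "0 < Re (W p)" if "p \<in> ?S" for p
    using that assms(4) unfolding W_def by (intro Re_polar_pos) (auto simp: mem_box_zero_Pair)
  have jac: "\<bar>Im (cnj (u p) * v p)\<bar> = J p" if "p \<in> ?S" for p
  proof -
    have W: "W p \<noteq> 0" using ReW[OF that] by auto
    have "cnj (u p) * v p = (cnj (D p) * D p) * (cnj (cis (snd p)) * cis (snd p)) * (fst p *\<^sub>R \<i>)"
      by (simp add: u_def v_def)
    also have "\<dots> = complex_of_real (fst p * (cmod (D p))\<^sup>2) * \<i>"
      by (simp add: complex_norm_square[symmetric] mult.commute[of "cnj _"] scaleR_conv_of_real)
    finally have "Im (cnj (u p) * v p) = fst p * (cmod (D p))\<^sup>2" by simp
    also have "cmod (D p) = cmod (W p) powr (\<alpha> - 1)"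
      unfolding D_def using norm_powr_real_powr'[of "complex_of_real \<alpha> - 1" "W p"] by simp
    also have "(cmod (W p) powr (\<alpha> - 1))\<^sup>2 = cmod (W p) powr (2 * \<alpha> - 2)"
      using W by (simp add: powr_add[symmetric] power2_eq_square)
    finally show ?thesis using that by (simp add: J_def mem_box_zero_Pair)
  qed
  have der: "(g has_derivative (\<lambda>h. fst h *\<^sub>R u p + snd h *\<^sub>R v p)) (at p)" if "p \<in> ?S" for p
  proof -
    have derW: "(W has_derivative (\<lambda>h. fst h *\<^sub>R cis (snd p) + snd h *\<^sub>R (fst p *\<^sub>R (\<i> * cis (snd p))))) (at p)"
      unfolding W_def
      by (auto intro!: derivative_eq_intros simp: fun_eq_iff scaleR_conv_of_real algebra_simps)
    have "(power_map \<alpha> has_field_derivative D p) (at (W p))"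
      unfolding power_map_def[abs_def] D_def using ReW[OF that] assms(1)
      by (auto intro!: derivative_eq_intros simp: complex_nonpos_Reals_iff)
    from has_derivative_compose[OF derW this[unfolded has_field_derivative_def]]
    show ?thesis
      unfolding g_def
      by (rule has_derivative_eq_rhs) (simp add: fun_eq_iff u_def v_def scaleR_conv_of_real algebra_simps)
  qed
  have inj: "inj_on g ?S"
  proof (rule inj_onI)
    fix p q assume pq: "p \<in> ?S" "q \<in> ?S" "g p = g q"
    have "0 < Im (W p)" "0 < Im (W q)"
      using pq by (auto simp: W_def mem_box_zero_Pair sin_gt_zero)
    then have "W p = W q"
      using power_map_inverse(2)[OF assms(1,2)] pq(3) unfolding g_def by metis
    then show "p = q"
      using inj_onD[OF inj_on_polar, of T p q] pq by (auto simp: W_def mem_box_zero_Pair mem_Times_iff)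
  qed
  have cont: "continuous_on (cbox (0, 0) (r, pi)) J"
  proof -
    have "continuous_on (cbox (0, 0) (r, pi)) (\<lambda>(s, \<theta>). cmod (complex_of_real T + s *\<^sub>R cis \<theta>) powr (2 * \<alpha> - 2))"
      using assms by (intro continuous_on_subset[OF continuous_on_polar_density]) (auto simp: cbox_Pair_eq)
    then show ?thesis
      unfolding J_def W_def by (auto intro!: continuous_intros simp: case_prod_beta)
  qed
  note box_int = set_integrable_box_of_continuous[OF cont]
  have int: "set_integrable lborel ?S (\<lambda>p. \<bar>Im (cnj (u p) * v p)\<bar>)"
    using box_int(1) by (subst set_integrable_cong[OF refl refl jac]) auto
  have area: "measure lebesgue (g ` ?S) = (LINT p:?S|lborel. \<bar>Im (cnj (u p) * v p)\<bar>)"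
    by (rule measure_image_eq_integral_jacobian(2)[OF open_box der inj int])
  show "open (sublevel \<alpha> a r)"
    unfolding img by (rule measure_image_eq_integral_jacobian(1)[OF open_box der inj int])
  have "sublevel_area \<alpha> a r = (LINT p:?S|lborel. J p)"
    unfolding sublevel_area_def img area using jac by (intro set_lebesgue_integral_cong) (simp, blast)
  also have "\<dots> = integral (cbox 0 r) (\<lambda>s. integral (cbox 0 pi) (\<lambda>\<theta>. J (s, \<theta>)))"
    unfolding box_int(2) by (rule integral_prod_continuous[OF cont])
  also have "\<dots> = integral {0..r} (\<lambda>s. s * arc_density \<alpha> T s)"
    by (simp add: J_def W_def arc_density_def)
  finally show "sublevel_area \<alpha> a r = integral {0..r} (\<lambda>s. s * arc_density \<alpha> T s)" .
qed

section \<open>Integrals of logarithmic derivatives\<close>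

text \<open>
  The integrand is the derivative of \<open>4 log r - 2 log A\<close>, and \<open>2 log A\<close> is monotone. The fundamental
  theorem of calculus for nonnegative derivatives therefore needs only one-sided limits of \<open>A\<close>;
  the derivative may blow up at \<open>T\<close>, as it does in the application when \<open>\<alpha> \<le> 1/2\<close>. At the lower end
  the logarithms combine to \<open>log (A \<tau> / \<tau>\<^sup>2)\<close>, which converges.
\<close>

lemma has_integral_from_0plus_log_derivative:
  fixes A A' :: "real \<Rightarrow> real"
  assumes T: "0 < T"
    and der: "\<And>r. 0 < r \<Longrightarrow> r < T \<Longrightarrow> (A has_real_derivative A' r) (at r)"
    and cont: "continuous_on {0<..<T} A'"
    and pos: "\<And>r. 0 < r \<Longrightarrow> r < T \<Longrightarrow> 0 < A r"
    and nonneg: "\<And>r. 0 < r \<Longrightarrow> r < T \<Longrightarrow> 0 \<le> A' r"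
    and left: "(A \<longlongrightarrow> L) (at_left T)" and L: "0 < L"
    and right: "((\<lambda>r. A r / r\<^sup>2) \<longlongrightarrow> k) (at_right 0)" and k: "0 < k"
  shows "has_integral_from_0plus (\<lambda>r. 4 / r - 2 * deriv A r / A r) T (2 * ln (k * T\<^sup>2 / L))"
proof -
  define f where "f = (\<lambda>r. 4 / r - 2 * deriv A r / A r)"
  define f' where "f' = (\<lambda>r. 4 / r - 2 * A' r / A r)"
  have contA: "isCont A r" if "0 < r" "r < T" for r
    using der[OF that] by (rule DERIV_isCont)
  have contA': "isCont A' r" if "0 < r" "r < T" for r
    using cont that by (simp add: continuous_on_eq_continuous_at)
  have main: "set_integrable lebesgue {\<tau>..T} f"
    "(LINT r:{\<tau>..T}|lebesgue. f r) = 4 * ln T - 2 * ln L + 2 * ln (A \<tau> / \<tau>\<^sup>2)"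
    if \<tau>: "0 < \<tau>" "\<tau> < T" for \<tau>
  proof -
    have "(A \<longlongrightarrow> A \<tau>) (at_right \<tau>)"
      using contA[OF \<tau>] by (simp add: isCont_def filterlim_at_split)
    then have "((\<lambda>r. 2 * ln (A r)) \<longlongrightarrow> 2 * ln (A \<tau>)) (at_right \<tau>)"
      using pos[OF \<tau>] by (intro tendsto_intros) auto
    then have lim\<tau>: "(((\<lambda>r. 2 * ln (A r)) \<circ> real_of_ereal) \<longlongrightarrow> 2 * ln (A \<tau>)) (at_right (ereal \<tau>))"
      by (simp add: ereal_tendsto_simps)
    have "((\<lambda>r. 2 * ln (A r)) \<longlongrightarrow> 2 * ln L) (at_left T)"
      using left L by (intro tendsto_intros) auto
    then have limT: "(((\<lambda>r. 2 * ln (A r)) \<circ> real_of_ereal) \<longlongrightarrow> 2 * ln L) (at_left (ereal T))"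
      by (simp add: ereal_tendsto_simps)
    have D: "DERIV (\<lambda>r. 2 * ln (A r)) r :> 2 * A' r / A r" if "ereal \<tau> < ereal r" "ereal r < ereal T" for r
      using that \<tau> pos by (auto intro!: derivative_eq_intros der)
    have C: "isCont (\<lambda>r. 2 * A' r / A r) r" if "ereal \<tau> < ereal r" "ereal r < ereal T" for r
      using that \<tau> pos[of r] by (intro continuous_intros contA contA') auto
    have N: "AE r in lborel. ereal \<tau> < ereal r \<longrightarrow> ereal r < ereal T \<longrightarrow> 0 \<le> 2 * A' r / A r"
    proof (intro AE_I2 impI)
      fix r assume "ereal \<tau> < ereal r" "ereal r < ereal T"
      with \<tau> pos[of r] nonneg[of r] show "0 \<le> 2 * A' r / A r" by simp
    qed
    have "ereal \<tau> < ereal T" using \<tau> by simp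
    note FTC = interval_integral_FTC_nonneg[OF this D C N lim\<tau> limT]
    have i1: "set_integrable lborel {\<tau><..<T} (\<lambda>r. 2 * A' r / A r)"
      using FTC(1) by simp
    have v1: "(LINT r:{\<tau><..<T}|lborel. 2 * A' r / A r) = 2 * ln L - 2 * ln (A \<tau>)"
      using FTC(2) \<tau> by (simp add: interval_lebesgue_integral_def)
    have "continuous_on (cbox \<tau> T) (\<lambda>r. 4 / r)"
      using \<tau> by (intro continuous_intros) auto
    note box4 = set_integrable_box_of_continuous[OF this]
    have "((\<lambda>r. 4 / r) has_integral (4 * ln T - 4 * ln \<tau>)) {\<tau>..T}"
      using \<tau> by (intro fundamental_theorem_of_calculus)
        (auto intro!: derivative_eq_intros simp: has_real_derivative_iff_has_vector_derivative[symmetric])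
    then have v2: "(LINT r:{\<tau><..<T}|lborel. 4 / r) = 4 * ln T - 4 * ln \<tau>"
      using box4(2) by (simp add: integral_unique box_real)
    have i2: "set_integrable lborel {\<tau><..<T} (\<lambda>r. 4 / r)"
      using box4(1) by (simp add: box_real)
    have if': "integrable lborel (\<lambda>r. indicator {\<tau><..<T} r *\<^sub>R f' r)"
      using set_integral_diff(1)[OF i2 i1] unfolding f'_def set_integrable_def .
    \<comment> \<open>Nothing is known about \<open>deriv A T\<close>, so \<open>f\<close> and \<open>f'\<close> are compared off the end points.\<close>
    have ends: "indicator {\<tau>..T} r *\<^sub>R f r = indicator {\<tau><..<T} r *\<^sub>R f' r" if "r \<notin> {\<tau>, T}" for r
      using that \<tau> DERIV_imp_deriv[OF der, of r] by (auto simp: f_def f'_def indicator_def)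
    have leb: "integrable lebesgue (\<lambda>r. indicator {\<tau><..<T} r *\<^sub>R f' r)"
      using if' integrable_completion[OF borel_measurable_integrable[OF if']] by simp
    show "set_integrable lebesgue {\<tau>..T} f"
      unfolding set_integrable_def
      by (rule integrable_discrete_difference[where X = "{\<tau>, T}", THEN iffD2, OF _ _ _ _ leb])
         (use ends in auto)
    have "(LINT r:{\<tau>..T}|lebesgue. f r) = (LINT r|lebesgue. indicator {\<tau><..<T} r *\<^sub>R f' r)"
      unfolding set_lebesgue_integral_def
      by (rule integral_discrete_difference[where X = "{\<tau>, T}"]) (use ends in auto)
    also have "\<dots> = (LINT r:{\<tau><..<T}|lborel. f' r)"
      using integral_completion[OF borel_measurable_integrable[OF if']]
      by (simp add: set_lebesgue_integral_def)
    also have "\<dots> = 4 * ln T - 4 * ln \<tau> - (2 * ln L - 2 * ln (A \<tau>))"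
      unfolding f'_def set_integral_diff(2)[OF i2 i1] v1 v2 ..
    also have "\<dots> = 4 * ln T - 2 * ln L + 2 * ln (A \<tau> / \<tau>\<^sup>2)"
      using \<tau> pos[OF \<tau>] by (simp add: ln_div ln_realpow)
    finally show "(LINT r:{\<tau>..T}|lebesgue. f r) = 4 * ln T - 2 * ln L + 2 * ln (A \<tau> / \<tau>\<^sup>2)" .
  qed
  have "((\<lambda>\<tau>. 4 * ln T - 2 * ln L + 2 * ln (A \<tau> / \<tau>\<^sup>2)) \<longlongrightarrow> 4 * ln T - 2 * ln L + 2 * ln k) (at_right 0)"
    using right k by (intro tendsto_intros) auto
  moreover have "\<forall>\<^sub>F \<tau> in at_right 0. 4 * ln T - 2 * ln L + 2 * ln (A \<tau> / \<tau>\<^sup>2) = (LINT r:{\<tau>..T}|lebesgue. f r)"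
    using T main(2) by (auto simp: eventually_at_right_field intro!: exI[of _ T])
  ultimately have "((\<lambda>\<tau>. LINT r:{\<tau>..T}|lebesgue. f r) \<longlongrightarrow> 4 * ln T - 2 * ln L + 2 * ln k) (at_right 0)"
    by (rule Lim_transform_eventually)
  also have "4 * ln T - 2 * ln L + 2 * ln k = 2 * ln (k * T\<^sup>2 / L)"
    using T L k by (simp add: ln_div ln_mult ln_realpow)
  finally show ?thesis
    using main(1) unfolding has_integral_from_0plus_def f_def by auto
qed

section \<open>The area at and near the ends of the radius interval\<close>

text \<open>
  The half-disc of radius \<open>T\<close> reaches the corner \<open>w = 0\<close>, where the Jacobian is singular. The open
  parametrisation by a rectangle is only used for smaller radii, which exhaust this sublevel set.
\<close>

lemma sublevel_at_T:
  assumes "0 < \<alpha>" "\<alpha> < 1" "0 < T" and T: "T = (\<alpha> * a) powr (1 / \<alpha>)"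
  shows "sublevel \<alpha> a T = (\<Union>r\<in>{0<..<T}. sublevel \<alpha> a r)"
    and "open (sublevel \<alpha> a T)" and "bounded (sublevel \<alpha> a T)"
proof -
  show un: "sublevel \<alpha> a T = (\<Union>r\<in>{0<..<T}. sublevel \<alpha> a r)"
  proof (intro set_eqI iffI)
    fix z assume z: "z \<in> sublevel \<alpha> a T"
    then obtain w where w: "z = power_map \<alpha> w" "0 < Im w" "cmod (w - complex_of_real T) < T"
      unfolding sublevel_eq_half_disc_image[OF assms(1-3) T] by auto
    obtain r where r: "cmod (w - complex_of_real T) < r" "r < T"
      using dense[OF w(3)] by blast
    then have "0 < r" using norm_ge_zero[of "w - complex_of_real T"] by linarith
    with w r have "z \<in> sublevel \<alpha> a r"
      unfolding sublevel_eq_half_disc_image[OF assms(1,2) \<open>0 < r\<close> T] by auto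
    with r \<open>0 < r\<close> show "z \<in> (\<Union>r\<in>{0<..<T}. sublevel \<alpha> a r)" by auto
  next
    fix z assume "z \<in> (\<Union>r\<in>{0<..<T}. sublevel \<alpha> a r)"
    then obtain r where r: "0 < r" "r < T" and z: "z \<in> sublevel \<alpha> a r" by auto
    show "z \<in> sublevel \<alpha> a T" by (rule subsetD[OF sublevel_mono[OF r(1) less_imp_le[OF r(2)]] z])
  qed
  show "open (sublevel \<alpha> a T)"
    unfolding un using sublevel_polar(1)[OF assms(1,2) _ _ T] by (intro open_UN) auto
  show "bounded (sublevel \<alpha> a T)"
    unfolding bounded_iff
  proof (intro exI ballI)
    fix z assume "z \<in> sublevel \<alpha> a T"
    then obtain w where w: "z = power_map \<alpha> w" "0 < Im w" "cmod (w - complex_of_real T) < T"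
      unfolding sublevel_eq_half_disc_image[OF assms(1-3) T] by auto
    have "cmod w \<le> cmod (w - complex_of_real T) + cmod (complex_of_real T)"
      using norm_triangle_ineq[of "w - complex_of_real T" "complex_of_real T"] by simp
    then have "cmod w \<le> 2 * T" using w(3) \<open>0 < T\<close> by simp
    then have "cmod w powr \<alpha> \<le> (2 * T) powr \<alpha>" using assms(1) by (intro powr_mono2) auto
    moreover have "cmod z = cmod w powr \<alpha> / \<alpha>"
      using norm_powr_real_powr'[of "complex_of_real \<alpha>" w] assms(1)
      by (simp add: w(1) power_map_def norm_divide)
    ultimately show "cmod z \<le> (2 * T) powr \<alpha> / \<alpha>"
      using assms(1) by (simp add: divide_right_mono)
  qed
qed

lemma measure_circular_sector:
  assumes "0 \<le> R" "0 \<le> \<beta>" "\<beta> \<le> pi"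
  shows "open ((\<lambda>p. fst p *\<^sub>R cis (snd p)) ` box (0, 0) (R, \<beta>))"
    and "measure lebesgue ((\<lambda>p. fst p *\<^sub>R cis (snd p)) ` box (0, 0) (R, \<beta>)) = \<beta> * R\<^sup>2 / 2"
proof -
  let ?S = "box (0, 0) (R, \<beta>) :: (real \<times> real) set"
  define g where "g = (\<lambda>p. fst p *\<^sub>R cis (snd p))"
  define u where "u = (\<lambda>p :: real \<times> real. cis (snd p))"
  define v where "v = (\<lambda>p. fst p *\<^sub>R (\<i> * cis (snd p)))"
  have jac: "\<bar>Im (cnj (u p) * v p)\<bar> = fst p" if "p \<in> ?S" for p
  proof -
    have "cnj (u p) * v p = fst p *\<^sub>R (\<i> * (cnj (cis (snd p)) * cis (snd p)))"
      by (simp add: u_def v_def)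
    also have "\<dots> = fst p *\<^sub>R \<i>"
      by (simp add: complex_norm_square[symmetric] mult.commute[of "cnj _"])
    finally show ?thesis using that by (simp add: mem_box_zero_Pair)
  qed
  have der: "(g has_derivative (\<lambda>h. fst h *\<^sub>R u p + snd h *\<^sub>R v p)) (at p)" for p
    unfolding g_def u_def v_def
    by (auto intro!: derivative_eq_intros simp: fun_eq_iff scaleR_conv_of_real algebra_simps)
  have inj: "inj_on g ?S"
  proof -
    have "?S \<subseteq> {0<..} \<times> {0<..<pi}"
      using assms by (auto simp: mem_box_zero_Pair)
    then show ?thesis using inj_on_subset[OF inj_on_polar[of 0]] by (simp add: g_def)
  qed
  have cont: "continuous_on (cbox (0, 0) (R, \<beta>)) (fst :: real \<times> real \<Rightarrow> real)"
    by (intro continuous_intros)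
  note box_int = set_integrable_box_of_continuous[OF cont]
  have int: "set_integrable lborel ?S (\<lambda>p. \<bar>Im (cnj (u p) * v p)\<bar>)"
    using box_int(1) by (subst set_integrable_cong[OF refl refl jac]) auto
  note area = measure_image_eq_integral_jacobian[OF open_box der inj int]
  show "open ((\<lambda>p. fst p *\<^sub>R cis (snd p)) ` ?S)" using area(1) by (simp add: g_def)
  have "measure lebesgue (g ` ?S) = (LINT p:?S|lborel. fst p)"
    unfolding area(2) using jac by (intro set_lebesgue_integral_cong) (simp, blast)
  also have "\<dots> = integral (cbox 0 R) (\<lambda>s. integral (cbox 0 \<beta>) (\<lambda>\<theta>. s))"
    unfolding box_int(2) using integral_prod_continuous[OF cont] by simp
  also have "\<dots> = \<beta> * integral {0..R} (\<lambda>s. s)"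
    using assms by simp
  also have "integral {0..R} (\<lambda>s. s) = R\<^sup>2 / 2"
    using assms ident_has_integral[of 0 R] by (simp add: integral_unique)
  finally show "measure lebesgue ((\<lambda>p. fst p *\<^sub>R cis (snd p)) ` ?S) = \<beta> * R\<^sup>2 / 2"
    by (simp add: g_def)
qed

text \<open>
  The half-disc \<open>|w - T| < T\<close> is \<open>|w| < 2T cos (arg w)\<close>, so it contains the sector \<open>|w| < T\<close>,
  \<open>0 < arg w < \<pi>/3\<close>. In the \<open>z\<close>-plane this is the circular sector of radius \<open>T\<^bsup>\<alpha>\<^esup>/\<alpha>\<close> and angle \<open>\<pi>\<alpha>/3\<close>,
  whose area has the required order \<open>1/\<alpha>\<close>.
\<close>

lemma sublevel_area_at_T_ge:
  assumes "0 < \<alpha>" "\<alpha> < 1" "0 < T" and T: "T = (\<alpha> * a) powr (1 / \<alpha>)"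
  shows "pi * T powr (2 * \<alpha>) / (6 * \<alpha>) \<le> sublevel_area \<alpha> a T"
proof -
  let ?R = "T powr \<alpha> / \<alpha>" and ?\<beta> = "pi * \<alpha> / 3"
  let ?E = "(\<lambda>p. fst p *\<^sub>R cis (snd p)) ` box (0, 0) (?R, ?\<beta>)"
  have \<beta>: "0 \<le> ?R" "0 \<le> ?\<beta>" "?\<beta> \<le> pi" using assms by (auto simp: mult_le_cancel_left1)
  note E = measure_circular_sector[OF \<beta>]
  have "?E \<subseteq> sublevel \<alpha> a T"
  proof (clarsimp simp: mem_box_zero_Pair)
    fix t \<theta> assume t: "0 < t" "t < T powr \<alpha> / \<alpha>" and \<theta>: "0 < \<theta>" "\<theta> * 3 < pi * \<alpha>"
    define \<rho> where "\<rho> = (\<alpha> * t) powr (1 / \<alpha>)"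
    define \<phi> where "\<phi> = \<theta> / \<alpha>"
    have \<phi>: "0 < \<phi>" "\<phi> < pi / 3" using \<theta> assms by (auto simp: \<phi>_def field_simps)
    have \<rho>: "0 < \<rho>" using t assms by (simp add: \<rho>_def)
    have "\<rho> < (T powr \<alpha>) powr (1 / \<alpha>)"
      unfolding \<rho>_def using t assms by (intro powr_less_mono2) (auto simp: field_simps)
    then have \<rho>T: "\<rho> < T" using assms(1,3) by (simp add: powr_powr)
    \<comment> \<open>The angle \<open>\<pi>/3\<close> is chosen so that \<open>2 T cos \<phi> > T\<close>.\<close>
    have cos: "1 / 2 < cos \<phi>"
      using \<phi> cos_monotone_0_pi[of \<phi> "pi / 3"] by (simp add: cos_60)
    define w where "w = complex_of_real \<rho> * cis \<phi>"
    have "0 < Im w" using \<rho> \<phi> by (simp add: w_def sin_gt_zero)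
    moreover have "cmod (w - complex_of_real T) < T"
    proof -
      have "(cmod (w - complex_of_real T))\<^sup>2 = (\<rho> * cos \<phi> - T)\<^sup>2 + (\<rho> * sin \<phi>)\<^sup>2"
        by (simp add: w_def cmod_power2)
      also have "\<dots> = \<rho>\<^sup>2 * ((cos \<phi>)\<^sup>2 + (sin \<phi>)\<^sup>2) - 2 * \<rho> * T * cos \<phi> + T\<^sup>2"
        by algebra
      also have "\<dots> = \<rho> * (\<rho> - 2 * T * cos \<phi>) + T\<^sup>2"
        by (simp add: power2_eq_square algebra_simps)
      also have "\<rho> * (\<rho> - 2 * T * cos \<phi>) < 0"
      proof (intro mult_pos_neg \<rho>)
        have "T * (1 / 2) < T * cos \<phi>" using cos assms by (intro mult_strict_left_mono) auto
        then show "\<rho> - 2 * T * cos \<phi> < 0" using \<rho>T by simp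
      qed
      finally have "(cmod (w - complex_of_real T))\<^sup>2 < T\<^sup>2" by simp
      then show ?thesis by (rule power2_less_imp_less) (simp add: less_imp_le[OF \<open>0 < T\<close>])
    qed
    moreover have "t *\<^sub>R cis \<theta> = power_map \<alpha> w"
    proof -
      have "w powr complex_of_real \<alpha> = complex_of_real (\<rho> powr \<alpha>) * cis (\<alpha> * \<phi>)"
        unfolding w_def using \<rho> \<phi> pi_gt_zero by (intro powr_of_real_polar) linarith+
      also have "\<dots> = complex_of_real (\<alpha> * t) * cis \<theta>"
        using t assms by (simp add: \<rho>_def \<phi>_def powr_powr)
      finally show ?thesis using assms by (simp add: power_map_def scaleR_conv_of_real)
    qed
    ultimately show "t *\<^sub>R cis \<theta> \<in> sublevel \<alpha> a T"
      unfolding sublevel_eq_half_disc_image[OF assms(1-3) T] by auto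
  qed
  moreover have "sublevel \<alpha> a T \<in> lmeasurable"
    using sublevel_at_T(2,3)[OF assms] by (intro lmeasurable_open)
  moreover have "?E \<in> sets lebesgue" using E(1) by simp
  ultimately have "measure lebesgue ?E \<le> sublevel_area \<alpha> a T"
    unfolding sublevel_area_def by (intro measure_mono_fmeasurable)
  also have "measure lebesgue ?E = pi * T powr (2 * \<alpha>) / (6 * \<alpha>)"
    unfolding E(2) using assms by (simp add: power2_eq_square powr_add[symmetric] field_simps)
  finally show ?thesis .
qed

text \<open>
  The formula for the area is only available below \<open>T\<close>; continuity of measure along increasing
  unions reaches the end point.
\<close>

lemma sublevel_area_tendsto_at_T:
  assumes "0 < \<alpha>" "\<alpha> < 1" "0 < T" and T: "T = (\<alpha> * a) powr (1 / \<alpha>)"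
  shows "(sublevel_area \<alpha> a \<longlongrightarrow> sublevel_area \<alpha> a T) (at_left T)"
proof (rule tendsto_at_left_sequentially[OF \<open>0 < T\<close>])
  fix S assume S: "\<And>n. S n < T" "\<And>n. 0 < S n" "incseq S" "S \<longlonglongrightarrow> T"
  have un: "(\<Union>n. sublevel \<alpha> a (S n)) = sublevel \<alpha> a T"
  proof
    show "(\<Union>n. sublevel \<alpha> a (S n)) \<subseteq> sublevel \<alpha> a T"
      using sublevel_mono[OF S(2) less_imp_le[OF S(1)]] by blast
    show "sublevel \<alpha> a T \<subseteq> (\<Union>n. sublevel \<alpha> a (S n))"
    proof
      fix z assume "z \<in> sublevel \<alpha> a T"
      then obtain r where r: "0 < r" "r < T" "z \<in> sublevel \<alpha> a r"
        unfolding sublevel_at_T(1)[OF assms] by auto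
      obtain n where "r < S n"
        using order_tendstoD(1)[OF S(4) r(2)] by (auto dest: eventually_happens)
      with sublevel_mono[OF r(1), of "S n"] r(3) show "z \<in> (\<Union>n. sublevel \<alpha> a (S n))" by auto
    qed
  qed
  have "sublevel \<alpha> a T \<in> lmeasurable"
    using sublevel_at_T(2,3)[OF assms] by (intro lmeasurable_open)
  then have fin: "emeasure lebesgue (\<Union>n. sublevel \<alpha> a (S n)) \<noteq> \<infinity>"
    unfolding un infinity_ennreal_def by (rule fmeasurableD2)
  have "range (\<lambda>n. sublevel \<alpha> a (S n)) \<subseteq> sets lebesgue"
    using sublevel_polar(1)[OF assms(1,2) S(2) S(1) T] by auto
  moreover have "incseq (\<lambda>n. sublevel \<alpha> a (S n))"
    using S(2,3) sublevel_mono unfolding incseq_def by blast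
  ultimately show "(\<lambda>n. sublevel_area \<alpha> a (S n)) \<longlonglongrightarrow> sublevel_area \<alpha> a T"
    using Lim_measure_incseq[OF _ _ fin] unfolding sublevel_area_def un by blast
qed

lemma sublevel_area_has_derivative:
  assumes "0 < \<alpha>" "\<alpha> < 1" "0 < r" "r < T" and T: "T = (\<alpha> * a) powr (1 / \<alpha>)"
  shows "(sublevel_area \<alpha> a has_real_derivative r * arc_density \<alpha> T r) (at r)"
proof -
  obtain b where b: "r < b" "b < T" using dense[OF \<open>r < T\<close>] by blast
  have cont: "continuous_on {0..b} (\<lambda>s. s * arc_density \<alpha> T s)"
    using b assms by (intro continuous_intros continuous_on_subset[OF continuous_on_arc_density]) auto
  have "((\<lambda>x. integral {0..x} (\<lambda>s. s * arc_density \<alpha> T s)) has_real_derivative r * arc_density \<alpha> T r) (at r within {0..b})"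
    using b assms by (intro integral_has_real_derivative[OF cont]) auto
  then have "((\<lambda>x. integral {0..x} (\<lambda>s. s * arc_density \<alpha> T s)) has_real_derivative r * arc_density \<alpha> T r) (at r)"
    using b assms by (simp add: at_within_Icc_at)
  then show ?thesis
  proof (rule DERIV_cong_ev[THEN iffD1, OF refl _ refl, rotated])
    have "\<forall>\<^sub>F x in nhds r. x \<in> {0<..<T}" using assms by (intro eventually_nhds_in_open) auto
    then show "\<forall>\<^sub>F x in nhds r. integral {0..x} (\<lambda>s. s * arc_density \<alpha> T s) = sublevel_area \<alpha> a x"
      by eventually_elim (use sublevel_polar(2)[OF assms(1,2) _ _ T] in auto)
  qed
qed

text \<open>
  The Jacobian \<open>|w|\<^bsup>2\<alpha>-2\<^esup>\<close> tends to \<open>T\<^bsup>2\<alpha>-2\<^esup>\<close> at \<open>w = T\<close>, so in the limit the area \<open>\<pi>r\<^sup>2/2\<close> of a small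
  half-disc is scaled by that factor.
\<close>

lemma sublevel_area_asymptotics:
  assumes "0 < \<alpha>" "\<alpha> < 1" "0 < T" and T: "T = (\<alpha> * a) powr (1 / \<alpha>)"
  shows "((\<lambda>r. sublevel_area \<alpha> a r / r\<^sup>2) \<longlongrightarrow> pi * T powr (2 * \<alpha> - 2) / 2) (at_right 0)"
proof (rule lhopital_right_0)
  have near: "\<forall>\<^sub>F r in at_right 0. 0 < r \<and> r < T"
    using \<open>0 < T\<close> by (auto simp: eventually_at_right_field)
  have "continuous_on {0..T/2} (\<lambda>s. s * arc_density \<alpha> T s)"
    using \<open>0 < T\<close> by (intro continuous_intros continuous_on_subset[OF continuous_on_arc_density]) auto
  then have "continuous_on {0..T/2} (\<lambda>x. integral {0..x} (\<lambda>s. s * arc_density \<alpha> T s))"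
    by (intro indefinite_integral_continuous_1 integrable_continuous_interval)
  then have "((\<lambda>x. integral {0..x} (\<lambda>s. s * arc_density \<alpha> T s)) \<longlongrightarrow> integral {0..0} (\<lambda>s. s * arc_density \<alpha> T s)) (at 0 within {0..T/2})"
    using \<open>0 < T\<close> unfolding continuous_on_def by (auto dest: bspec[where x = 0])
  then have "((\<lambda>x. integral {0..x} (\<lambda>s. s * arc_density \<alpha> T s)) \<longlongrightarrow> 0) (at_right 0)"
    using \<open>0 < T\<close> by (simp add: at_within_Icc_at_right)
  then show "(sublevel_area \<alpha> a \<longlongrightarrow> 0) (at_right 0)"
  proof (rule Lim_transform_eventually)
    show "\<forall>\<^sub>F x in at_right 0. integral {0..x} (\<lambda>s. s * arc_density \<alpha> T s) = sublevel_area \<alpha> a x"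
      using near by eventually_elim (use sublevel_polar(2)[OF assms(1,2) _ _ T] in auto)
  qed
  show "((\<lambda>r. r\<^sup>2) \<longlongrightarrow> 0) (at_right (0::real))" by (auto intro!: tendsto_eq_intros)
  show "\<forall>\<^sub>F r in at_right 0. r\<^sup>2 \<noteq> (0::real)" "\<forall>\<^sub>F r in at_right 0. 2 * r \<noteq> (0::real)"
    using near by (eventually_elim, simp)+
  show "\<forall>\<^sub>F r in at_right 0. DERIV (sublevel_area \<alpha> a) r :> r * arc_density \<alpha> T r"
    using near by eventually_elim (use sublevel_area_has_derivative[OF assms(1,2) _ _ T] in auto)
  show "\<forall>\<^sub>F r in at_right 0. DERIV (\<lambda>r. r\<^sup>2) r :> 2 * (r::real)"
    by (intro always_eventually allI) (auto intro!: derivative_eq_intros)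
  have "(arc_density \<alpha> T \<longlongrightarrow> arc_density \<alpha> T 0) (at_right 0)"
    using continuous_on_arc_density[of T \<alpha>] \<open>0 < T\<close>
    by (simp add: continuous_on_eq_continuous_at isCont_def filterlim_at_split)
  also have "arc_density \<alpha> T 0 = pi * T powr (2 * \<alpha> - 2)"
    using \<open>0 < T\<close> by (simp add: arc_density_def)
  finally have "((\<lambda>r. arc_density \<alpha> T r / 2) \<longlongrightarrow> pi * T powr (2 * \<alpha> - 2) / 2) (at_right 0)"
    by (intro tendsto_intros) auto
  then show "((\<lambda>r. r * arc_density \<alpha> T r / (2 * r)) \<longlongrightarrow> pi * T powr (2 * \<alpha> - 2) / 2) (at_right 0)"
    by (rule Lim_transform_eventually) (use near in eventually_elim, simp)
qed

section \<open>The integral estimate\<close>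

theorem proposition8:
  "\<exists>C::real. \<forall>\<alpha> a T :: real.
     0 < \<alpha> \<and> \<alpha> < 1 \<and> 0 < a \<and> T = (\<alpha> * a) powr (1 / \<alpha>) \<longrightarrow>
       (\<forall>r\<in>{0<..<T}. sublevel \<alpha> a r \<in> lmeasurable
          \<and> 0 < sublevel_area \<alpha> a r
          \<and> sublevel_area \<alpha> a differentiable (at r)) \<and>
       (\<exists>I. has_integral_from_0plus
              (\<lambda>r. 4 / r - 2 * deriv (sublevel_area \<alpha> a) r / sublevel_area \<alpha> a r) T I
            \<and> I \<le> - C + 2 * ln \<alpha>)"
proof (intro exI[of _ "- 2 * ln 3"] allI impI, elim conjE)
  fix \<alpha> a T :: real
  assume \<alpha>: "0 < \<alpha>" "\<alpha> < 1" and a: "0 < a" and T: "T = (\<alpha> * a) powr (1 / \<alpha>)"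
  have T0: "0 < T" using \<alpha> a by (simp add: T)
  define L where "L = sublevel_area \<alpha> a T"
  define k where "k = pi * T powr (2 * \<alpha> - 2) / 2"
  have lmeas: "sublevel \<alpha> a r \<in> lmeasurable" if "0 < r" "r < T" for r
  proof (rule lmeasurable_open)
    have "sublevel \<alpha> a r \<subseteq> sublevel \<alpha> a T" using that by (intro sublevel_mono) auto
    then show "bounded (sublevel \<alpha> a r)"
      by (rule bounded_subset[OF sublevel_at_T(3)[OF \<alpha> T0 T]])
  qed (rule sublevel_polar(1)[OF \<alpha> that T])
  have pos: "0 < sublevel_area \<alpha> a r" if r: "0 < r" "r < T" for r
  proof -
    have "(\<lambda>p. complex_of_real T + fst p *\<^sub>R cis (snd p)) ` box (0, 0) (r, pi) \<noteq> {}"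
      using r mem_box_zero_Pair[of "(r / 2, pi / 2)" r pi] by auto
    then have "sublevel \<alpha> a r \<noteq> {}"
      unfolding sublevel_eq_half_disc_image[OF \<alpha> r(1) T] half_disc_eq_polar_image by simp
    then have "\<not> negligible (sublevel \<alpha> a r)"
      using open_not_negligible sublevel_polar(1)[OF \<alpha> r T] by blast
    then have "sublevel_area \<alpha> a r \<noteq> 0"
      using negligible_iff_measure0[OF lmeas[OF r]] by (simp add: sublevel_area_def)
    then show ?thesis by (simp add: sublevel_area_def zero_less_measure_iff)
  qed
  note der = sublevel_area_has_derivative[OF \<alpha> _ _ T]
  have diff: "sublevel_area \<alpha> a differentiable (at r)" if "0 < r" "r < T" for r
    using der[OF that] real_differentiable_def by blast
  have L: "pi * T powr (2 * \<alpha>) / (6 * \<alpha>) \<le> L"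
    unfolding L_def by (rule sublevel_area_at_T_ge[OF \<alpha> T0 T])
  have low: "0 < pi * T powr (2 * \<alpha>) / (6 * \<alpha>)" using \<alpha> T0 by simp
  with L have L0: "0 < L" by linarith
  have k0: "0 < k" using T0 by (simp add: k_def)
  have "has_integral_from_0plus (\<lambda>r. 4 / r - 2 * deriv (sublevel_area \<alpha> a) r / sublevel_area \<alpha> a r)
      T (2 * ln (k * T\<^sup>2 / L))"
  proof (rule has_integral_from_0plus_log_derivative[OF T0 der _ pos])
    show "continuous_on {0<..<T} (\<lambda>r. r * arc_density \<alpha> T r)"
      using T0 by (intro continuous_intros continuous_on_subset[OF continuous_on_arc_density]) auto
    \<comment> \<open>A non-integrable function has integral 0, so both cases give a nonnegative value.\<close>
    show "0 \<le> r * arc_density \<alpha> T r" if "0 < r" "r < T" for r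
      using that unfolding arc_density_def
      by (cases "(\<lambda>\<theta>. cmod (complex_of_real T + r *\<^sub>R cis \<theta>) powr (2 * \<alpha> - 2)) integrable_on {0..pi}")
         (auto intro!: mult_nonneg_nonneg integral_nonneg simp: not_integrable_integral)
    show "(sublevel_area \<alpha> a \<longlongrightarrow> L) (at_left T)"
      unfolding L_def by (rule sublevel_area_tendsto_at_T[OF \<alpha> T0 T])
    show "((\<lambda>r. sublevel_area \<alpha> a r / r\<^sup>2) \<longlongrightarrow> k) (at_right 0)"
      unfolding k_def by (rule sublevel_area_asymptotics[OF \<alpha> T0 T])
  qed (use L0 k0 in auto)
  moreover have "2 * ln (k * T\<^sup>2 / L) \<le> - (- 2 * ln 3) + 2 * ln \<alpha>"
  proof -
    have "k * T\<^sup>2 = pi * T powr (2 * \<alpha>) / 2"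
      using T0 by (simp add: k_def powr_diff powr_numeral)
    also have "\<dots> = 3 * \<alpha> * (pi * T powr (2 * \<alpha>) / (6 * \<alpha>))"
      using \<alpha> by simp
    also have "\<dots> \<le> 3 * \<alpha> * L"
      using L \<alpha> by (intro mult_left_mono) auto
    finally have "k * T\<^sup>2 / L \<le> 3 * \<alpha>"
      using L0 by (simp add: divide_le_eq)
    then have "ln (k * T\<^sup>2 / L) \<le> ln (3 * \<alpha>)"
      using k0 T0 L0 by (intro ln_mono) auto
    also have "\<dots> = ln 3 + ln \<alpha>"
      using \<alpha> by (simp add: ln_mult)
    finally show ?thesis by simp
  qed
  ultimately show "(\<forall>r\<in>{0<..<T}. sublevel \<alpha> a r \<in> lmeasurable
          \<and> 0 < sublevel_area \<alpha> a r
          \<and> sublevel_area \<alpha> a differentiable (at r)) \<and>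
       (\<exists>I. has_integral_from_0plus
              (\<lambda>r. 4 / r - 2 * deriv (sublevel_area \<alpha> a) r / sublevel_area \<alpha> a r) T I
            \<and> I \<le> - (- 2 * ln 3) + 2 * ln \<alpha>)"
    using lmeas pos diff by auto
qed

end
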